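(* Let $\mathbb{X}$ be a finite-dimensional Euclidean space, $f:\mathbb{X}\to\mathbb{R}$ continuously differentiable, $P_1,P_2:\mathbb{X}\to\mathbb{R}$ convex, $\sigma>0$, and suppose $\mathcal{F}:=\{x\in\mathbb{X}:P_1(x)-P_2(x)\le\sigma\}$ is nonempty and compact. Suppose that for every $y\in\mathcal{F}$ and $\xi\in\partial P_2(y)$ there exists $x^\odot_{(y,\xi)}\in\mathbb{X}$ with $P_1(x^\odot_{(y,\xi)})-P_2(y)-\langle\xi,x^\odot_{(y,\xi)}-y\rangle<\sigma$. Let $\{x^k\}$ be an infinite sequence generated by the Frank-Wolfe-type algorithm (FW) described in the context, and let $G:\mathcal{F}\to\mathbb{R}$ be defined by $G(x)=\inf_{\xi\in\partial P_2(x)}\max_{y\in\mathcal{F}(x,\xi)}\langle\nabla f(x),x-y\rangle$. Then the sequence $\{x^k\}$ is bounded and $G(x^k)\to0$ as $k\to\infty$. Moreover, any accumulation point of $\{x^k\}$ is a stationary point of the problem $\min\{f(x):x\in\mathcal{F}\}$.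
   Context: $\partial P_i$ is the subdifferential of convex analysis. For $y\in\mathcal{F}$, $\xi\in\partial P_2(y)$: $\mathcal{F}(y,\xi):=\{x\in\mathbb{X}:P_1(x)-\langle\xi,x-y\rangle-P_2(y)\le\sigma\}$. For $a\in\mathbb{X}$, the linear-optimization oracle $\mathcal{LO}(a,y,\xi)$ returns a solution of $\min\{\langle a,x\rangle:x\in\mathcal{F}(y,\xi)\}$. Stationary point: $x^*\in\mathbb{X}$ is a stationary point of $\min\{f(x):P_1(x)-P_2(x)\le\sigma\}$ if there exists $\lambda_*\ge0$ with $0\in\nabla f(x^* )+\lambda_*(\partial P_1(x^* )-\partial P_2(x^* ))$, $\lambda_*(P_1(x^* )-P_2(x^* )-\sigma)=0$ and $P_1(x^* )-P_2(x^* )\le\sigma$. Algorithm (FW). Step 0: Choose $x^0\in\mathcal{F}$, $c,\eta\in(0,1)$, and a sequence $\{\alpha_k^0\}\subseteq(0,1]$ with $\inf_k\alpha_k^0>0$. Set $k=0$. Step 1: Pick $\xi^k\in\partial P_2(x^k)$, let $u^k$ be an output of $\mathcal{LO}(\nabla f(x^k),x^k,\xi^k)$, and let $d^k:=u^k-x^k$. If $\langle\nabla f(x^k),d^k\rangle=0$, terminate. Step 2: Find $\alpha_k=\alpha_k^0\eta^{j_k}$ with $j_k$ the smallest nonnegative integer such that $f(x^k+\alpha_kd^k)\le f(x^k)+c\alpha_k\langle\nabla f(x^k),d^k\rangle$. Step 3: Set $\widehat x^{k+1}=x^k+\alpha_kd^k$. Choose $x^{k+1}\in\mathcal{F}$ such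 that $f(x^{k+1})\le f(\widehat x^{k+1})$. Update $k\leftarrow k+1$ and go to Step 1. *)

theory Defs
  imports "HOL-Analysis.Analysis"
begin

definition subdifferential :: "('a::real_inner \<Rightarrow> real) \<Rightarrow> 'a \<Rightarrow> 'a set" where
  "subdifferential P x = {g. \<forall>z. P x + g \<bullet> (z - x) \<le> P z}"

definition feasible_set :: "('a \<Rightarrow> real) \<Rightarrow> ('a \<Rightarrow> real) \<Rightarrow> real \<Rightarrow> 'a set" where
  "feasible_set P1 P2 \<sigma> = {x. P1 x - P2 x \<le> \<sigma>}"

definition linearized_set ::
  "('a::real_inner \<Rightarrow> real) \<Rightarrow> ('a \<Rightarrow> real) \<Rightarrow> real \<Rightarrow> 'a \<Rightarrow> 'a \<Rightarrow> 'a set" where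
  "linearized_set P1 P2 \<sigma> y \<xi> = {x. P1 x - \<xi> \<bullet> (x - y) - P2 y \<le> \<sigma>}"

(* The relation "u is an output of the linear-optimization oracle LO(a, y, xi)": the oracle may
   return any minimizer. *)
definition is_LO_output ::
  "('a::real_inner \<Rightarrow> real) \<Rightarrow> ('a \<Rightarrow> real) \<Rightarrow> real \<Rightarrow> 'a \<Rightarrow> 'a \<Rightarrow> 'a \<Rightarrow> 'a \<Rightarrow> bool" where
  "is_LO_output P1 P2 \<sigma> a y \<xi> u \<longleftrightarrow>
     is_arg_min (\<lambda>x. a \<bullet> x) (\<lambda>x. x \<in> linearized_set P1 P2 \<sigma> y \<xi>) u"

(* In the definitions below, gf stands for the gradient of f. *)

definition stationary_point ::
  "('a::real_inner \<Rightarrow> 'a) \<Rightarrow> ('a \<Rightarrow> real) \<Rightarrow> ('a \<Rightarrow> real) \<Rightarrow> real \<Rightarrow> 'a \<Rightarrow> bool" where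
  "stationary_point gf P1 P2 \<sigma> x \<longleftrightarrow>
     (\<exists>\<mu>\<ge>0.
        0 \<in> {gf x + \<mu> *\<^sub>R (p - q) | p q. p \<in> subdifferential P1 x \<and> q \<in> subdifferential P2 x} \<and>
        \<mu> * (P1 x - P2 x - \<sigma>) = 0 \<and>
        P1 x - P2 x \<le> \<sigma>)"

(* The supremum is a maximum and the infimum is over a set bounded below by 0 whenever x is
   feasible, the feasible set is compact and P1 is convex; see the two lemmas below. *)
definition gap_function ::
  "('a::real_inner \<Rightarrow> 'a) \<Rightarrow> ('a \<Rightarrow> real) \<Rightarrow> ('a \<Rightarrow> real) \<Rightarrow> real \<Rightarrow> 'a \<Rightarrow> real" where
  "gap_function gf P1 P2 \<sigma> x =
     (INF \<xi>\<in>subdifferential P2 x. SUP y\<in>linearized_set P1 P2 \<sigma> x \<xi>. gf x \<bullet> (x - y))"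

definition armijo ::
  "('a::real_inner \<Rightarrow> real) \<Rightarrow> ('a \<Rightarrow> 'a) \<Rightarrow> real \<Rightarrow> 'a \<Rightarrow> 'a \<Rightarrow> real \<Rightarrow> bool" where
  "armijo f gf c x d \<alpha> \<longleftrightarrow> f (x + \<alpha> *\<^sub>R d) \<le> f x + c * \<alpha> * (gf x \<bullet> d)"

(* A run of the algorithm that never terminates: at every iteration the stopping test in Step 1
   fails and the line search in Step 2 ends after j k trials. *)
definition FW_infinite_run ::
  "('a::real_inner \<Rightarrow> real) \<Rightarrow> ('a \<Rightarrow> 'a) \<Rightarrow> ('a \<Rightarrow> real) \<Rightarrow> ('a \<Rightarrow> real) \<Rightarrow> real \<Rightarrow>
   real \<Rightarrow> real \<Rightarrow> (nat \<Rightarrow> real) \<Rightarrow>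
   (nat \<Rightarrow> 'a) \<Rightarrow> (nat \<Rightarrow> 'a) \<Rightarrow> (nat \<Rightarrow> 'a) \<Rightarrow> (nat \<Rightarrow> nat) \<Rightarrow> bool" where
  "FW_infinite_run f gf P1 P2 \<sigma> c \<eta> \<alpha>0 x \<xi> u j \<longleftrightarrow>
     x 0 \<in> feasible_set P1 P2 \<sigma> \<and>
     c \<in> {0<..<1} \<and> \<eta> \<in> {0<..<1} \<and>
     (\<forall>k. \<alpha>0 k \<in> {0<..1}) \<and> (INF k. \<alpha>0 k) > 0 \<and>
     (\<forall>k. let d = u k - x k; \<alpha> = (\<lambda>i. \<alpha>0 k * \<eta> ^ i) in
        \<xi> k \<in> subdifferential P2 (x k) \<and>
        is_LO_output P1 P2 \<sigma> (gf (x k)) (x k) (\<xi> k) (u k) \<and>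
        gf (x k) \<bullet> d \<noteq> 0 \<and>
        armijo f gf c (x k) d (\<alpha> (j k)) \<and>
        (\<forall>i<j k. \<not> armijo f gf c (x k) d (\<alpha> i)) \<and>
        x (Suc k) \<in> feasible_set P1 P2 \<sigma> \<and>
        f (x (Suc k)) \<le> f (x k + \<alpha> (j k) *\<^sub>R d))"

(* Accumulation point of a sequence (not of its range): limit of a subsequence. *)
definition accumulation_point :: "(nat \<Rightarrow> 'a::topological_space) \<Rightarrow> 'a \<Rightarrow> bool" where
  "accumulation_point x l \<longleftrightarrow> (\<exists>r::nat \<Rightarrow> nat. strict_mono r \<and> (x \<circ> r) \<longlonglongrightarrow> l)"

lemma gap_function_max_attained:
  fixes P1 P2 :: "'a::euclidean_space \<Rightarrow> real"
  assumes "convex_on UNIV P1" "compact (feasible_set P1 P2 \<sigma>)"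
    and "x \<in> feasible_set P1 P2 \<sigma>" "\<xi> \<in> subdifferential P2 x"
  shows "\<exists>y\<in>linearized_set P1 P2 \<sigma> x \<xi>.
           gf x \<bullet> (x - y) = (SUP y\<in>linearized_set P1 P2 \<sigma> x \<xi>. gf x \<bullet> (x - y)) \<and>
           (\<forall>z\<in>linearized_set P1 P2 \<sigma> x \<xi>. gf x \<bullet> (x - z) \<le> gf x \<bullet> (x - y))"
proof -
  let ?L = "linearized_set P1 P2 \<sigma> x \<xi>"
  have P1: "continuous_on UNIV P1"
    using assms(1) by (intro convex_on_continuous) auto
  have "closed ?L"
    unfolding linearized_set_def
    by (intro closed_Collect_le continuous_intros P1)
  moreover have "?L \<subseteq> feasible_set P1 P2 \<sigma>"
  proof
    fix z assume "z \<in> ?L"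
    moreover have "P2 x + \<xi> \<bullet> (z - x) \<le> P2 z"
      using assms(4) by (simp add: subdifferential_def)
    ultimately show "z \<in> feasible_set P1 P2 \<sigma>"
      by (simp add: linearized_set_def feasible_set_def)
  qed
  ultimately have "compact ?L"
    using assms(2) by (metis compact_Int_closed inf.absorb_iff2)
  moreover have "?L \<noteq> {}"
    using assms(3) by (auto simp: linearized_set_def feasible_set_def intro!: exI[of _ x])
  moreover have "continuous_on ?L (\<lambda>y. gf x \<bullet> (x - y))"
    by (intro continuous_intros)
  ultimately obtain y where y: "y \<in> ?L" "\<forall>z\<in>?L. gf x \<bullet> (x - z) \<le> gf x \<bullet> (x - y)"
    using continuous_attains_sup by blast
  then have "(SUP y\<in>?L. gf x \<bullet> (x - y)) = gf x \<bullet> (x - y)"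
    by (intro cSup_eq_maximum) auto
  with y show ?thesis by metis
qed

lemma gap_function_max_nonneg:
  fixes P1 P2 :: "'a::euclidean_space \<Rightarrow> real"
  assumes "convex_on UNIV P1" "compact (feasible_set P1 P2 \<sigma>)"
    and "x \<in> feasible_set P1 P2 \<sigma>" "\<xi> \<in> subdifferential P2 x"
  shows "0 \<le> (SUP y\<in>linearized_set P1 P2 \<sigma> x \<xi>. gf x \<bullet> (x - y))"
proof -
  have "x \<in> linearized_set P1 P2 \<sigma> x \<xi>"
    using assms(3) by (simp add: linearized_set_def feasible_set_def)
  then show ?thesis
    using gap_function_max_attained[OF assms, of gf] by fastforce
qed

end

theory Submission
  imports Defs
begin

text \<open>
  Write \<open>d k = u k - x k\<close> and \<open>g k = gf (x k) \<bullet> d k\<close>, and \<open>\<alpha>\<^sub>k\<close> for the accepted step. Since \<open>\<xi> k\<close> is a subgradient of \<open>P2\<close>,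
  the linearized set at \<open>x k\<close> lies inside the feasible set and contains \<open>x k\<close>. Hence all the
  points \<open>x k\<close> and \<open>u k\<close> stay in one compact set, and \<open>g k \<le> 0\<close>.

  The line search makes \<open>f (x k)\<close> decrease by at least \<open>- c \<alpha>\<^sub>k g k\<close>, and \<open>f\<close> is bounded below on
  the feasible set, so \<open>\<alpha>\<^sub>k g k \<longlonglongrightarrow> 0\<close>. By uniform continuity of the gradient on compact sets, all
  sufficiently short steps pass the Armijo test as long as \<open>g k\<close> stays away from \<open>0\<close>
  (\<open>armijo_accepts_short_steps\<close>). So \<open>\<alpha>\<^sub>k\<close> can be small only where \<open>g k\<close> is small, and therefore
  \<open>g k \<longlonglongrightarrow> 0\<close>. The value \<open>- g k\<close> is the inner maximum of the gap function for the particular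
  subgradient \<open>\<xi> k\<close>, so it dominates the nonnegative gap, which tends to \<open>0\<close> as well.

  Now let \<open>l\<close> be an accumulation point. The subgradients \<open>\<xi> k\<close> are bounded, because the \<open>x k\<close> are
  and \<open>P2\<close> is finite everywhere, so along a further subsequence they converge to some \<open>\<zeta>\<close>, which
  is a subgradient of \<open>P2\<close> at \<open>l\<close>. If \<open>y\<close> satisfies the constraint linearized at \<open>(l, \<zeta>)\<close> with
  strict inequality, then it satisfies the one linearized at \<open>(x k, \<xi> k)\<close> for all late \<open>k\<close> of the
  subsequence. The oracle then gives \<open>gf (x k) \<bullet> (y - x k) \<ge> g k\<close>, and in the limit
  \<open>gf l \<bullet> (y - l) \<ge> 0\<close>: \<open>l\<close> minimizes a linear function over a convex set. This set has a Slater point by assumption, so a Lagrange multiplier exists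
  (\<open>lagrange_multiplier_exists\<close>), and it is the multiplier that stationarity asks for.
\<close>

section \<open>Subgradients of finite convex functions\<close>

text \<open>
  A hyperplane that separates the epigraph from the open vertical ray below the graph point over
  \<open>x\<close> cannot be vertical, because the epigraph projects onto the whole space. Its slope is a
  subgradient.
\<close>
lemma subdifferential_nonempty:
  fixes P :: "'a::euclidean_space \<Rightarrow> real"
  assumes "convex_on UNIV P"
  shows "subdifferential P x \<noteq> {}"
proof -
  let ?S = "{x} \<times> {..<P x}"
  have "convex ?S" "?S \<noteq> {}"
    by (auto intro: convex_Times lt_ex)
  moreover have "convex (epigraph UNIV P)" "epigraph UNIV P \<noteq> {}"
    using assms mem_epigraph[of x "P x" UNIV P] by (auto simp: convex_epigraph)
  moreover have "?S \<inter> epigraph UNIV P = {}"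
    by (auto simp: epigraph_def)
  ultimately obtain a \<beta> where "a \<noteq> 0" and below: "\<forall>z\<in>?S. a \<bullet> z \<le> \<beta>"
      and above: "\<forall>z\<in>epigraph UNIV P. a \<bullet> z \<ge> \<beta>"
    using separating_hyperplane_sets by metis
  obtain g b where a: "a = (g, b)"
    by (cases a)
  have sep: "g \<bullet> x + b * (P x - e) \<le> g \<bullet> y + b * P y" if "e > 0" for e y
  proof -
    have "a \<bullet> (x, P x - e) \<le> \<beta>"
      using below that by auto
    also have "\<beta> \<le> a \<bullet> (y, P y)"
      using above by (auto simp: mem_epigraph)
    finally show ?thesis
      by (simp add: a inner_Pair)
  qed
  have "b \<ge> 0"
    using sep[of 1 x] by (simp add: algebra_simps)
  moreover have "b \<noteq> 0"
  proof
    assume "b = 0"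
    then have "g \<bullet> g \<le> 0"
      using sep[of 1 "x - g"] by (simp add: inner_diff_right)
    then have "g = 0"
      using inner_gt_zero_iff[of g] by linarith
    with \<open>b = 0\<close> \<open>a \<noteq> 0\<close> a show False
      by (simp add: zero_prod_def)
  qed
  ultimately have "b > 0"
    by simp
  have "P x + (- g /\<^sub>R b) \<bullet> (y - x) \<le> P y" for y
  proof (rule field_le_epsilon)
    fix e :: real
    assume "e > 0"
    from sep[OF this, of y] \<open>b > 0\<close>
    show "P x + (- g /\<^sub>R b) \<bullet> (y - x) \<le> P y + e"
      by (simp add: inner_diff_right field_simps)
  qed
  then show ?thesis
    unfolding subdifferential_def by blast
qed

text \<open>
  Moving from \<open>x\<close> by one unit along a subgradient increases \<open>P\<close> by at least the norm of the
  subgradient, while \<open>P\<close>, being continuous, is bounded on every ball.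
\<close>
lemma bounded_subdifferential_image:
  fixes P :: "'a::euclidean_space \<Rightarrow> real"
  assumes "convex_on UNIV P" "bounded S"
  shows "bounded (\<Union>x\<in>S. subdifferential P x)"
proof -
  obtain B where B: "\<And>x. x \<in> S \<Longrightarrow> norm x \<le> B"
    using assms(2) by (auto simp: bounded_iff)
  have "continuous_on (cball 0 (B + 1)) P"
    using convex_on_continuous[OF open_UNIV assms(1)] continuous_on_subset by blast
  then have "bounded (P ` cball 0 (B + 1))"
    by (intro compact_imp_bounded compact_continuous_image) auto
  then obtain M where M: "\<And>x. norm x \<le> B + 1 \<Longrightarrow> \<bar>P x\<bar> \<le> M"
    unfolding bounded_iff by (metis imageI mem_cball_0 real_norm_def)
  have "norm g \<le> 2 * M" if "x \<in> S" "g \<in> subdifferential P x" for x g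
  proof -
    let ?z = "x + sgn g"
    have "norm (sgn g) \<le> 1"
      by (simp add: norm_sgn)
    then have "norm ?z \<le> B + 1"
      using B[OF that(1)] norm_triangle_ineq[of x "sgn g"] by linarith
    then have "\<bar>P ?z\<bar> \<le> M" "\<bar>P x\<bar> \<le> M"
      using M B[OF that(1)] by fastforce+
    moreover have "P x + g \<bullet> (?z - x) \<le> P ?z"
      using that(2) unfolding subdifferential_def by blast
    moreover have "g \<bullet> (?z - x) = norm g"
      by (simp add: sgn_div_norm dot_square_norm power2_eq_square divide_simps)
    ultimately show ?thesis
      by linarith
  qed
  then show ?thesis
    by (auto simp: bounded_iff)
qed

lemma subdifferential_closed_graph:
  assumes "\<And>k. g k \<in> subdifferential P (x k)"
    and "x \<longlonglongrightarrow> l" "g \<longlonglongrightarrow> \<zeta>" "continuous_on UNIV P"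
  shows "\<zeta> \<in> subdifferential P l"
proof -
  have "(\<lambda>k. P (x k)) \<longlonglongrightarrow> P l"
    using continuous_on_tendsto_compose[OF assms(4,2)] by simp
  then have "(\<lambda>k. P (x k) + g k \<bullet> (z - x k)) \<longlonglongrightarrow> P l + \<zeta> \<bullet> (z - l)" for z
    by (intro tendsto_intros assms)
  moreover have "P (x k) + g k \<bullet> (z - x k) \<le> P z" for z k
    using assms(1)[of k] by (simp add: subdifferential_def)
  ultimately have "P l + \<zeta> \<bullet> (z - l) \<le> P z" for z
    using LIMSEQ_le_const2 by blast
  then show ?thesis
    by (simp add: subdifferential_def)
qed

section \<open>A Lagrange multiplier for one convex constraint\<close>

text \<open>
  A suitable \<open>\<mu>\<close> must satisfy \<open>\<mu> \<le> s z / - h z\<close> wherever \<open>h z < 0\<close>, and \<open>\<mu> \<ge> - s y / h y\<close> wherever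
  \<open>h y > 0\<close>. Each lower bound is at most each upper bound: on the segment from \<open>z\<close> to \<open>y\<close>, take the
  point where the linear interpolation of \<open>h\<close> is \<open>0\<close>. By convexity \<open>h \<le> 0\<close> there, hence \<open>s \<ge> 0\<close>, and
  convexity again makes the linear interpolation of \<open>s\<close> nonnegative, which is the comparison of
  the two bounds. Where \<open>h = 0\<close>, \<open>s \<ge> 0\<close> follows by moving slightly towards the Slater point.
\<close>
lemma lagrange_multiplier_exists:
  fixes h s :: "'a::real_vector \<Rightarrow> real"
  assumes "convex_on S h" "convex_on S s"
    and strict: "\<And>y. y \<in> S \<Longrightarrow> h y < 0 \<Longrightarrow> 0 \<le> s y"
    and slater: "w \<in> S" "h w < 0"
  shows "\<exists>\<mu>\<ge>0. \<forall>y\<in>S. 0 \<le> s y + \<mu> * h y"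
proof -
  have mem: "(1 - t) *\<^sub>R z + t *\<^sub>R y \<in> S" if "z \<in> S" "y \<in> S" "0 \<le> t" "t \<le> 1" for t y z
    using convex_on_imp_convex[OF assms(1)] that by (simp add: convex_alt)
  have weak: "0 \<le> s y" if "y \<in> S" "h y \<le> 0" for y
  proof (rule ccontr)
    assume neg: "\<not> 0 \<le> s y"
    have "0 \<le> s w"
      using strict slater by blast
    \<comment> \<open>Half of the weight at which the interpolated value of \<open>s\<close> between \<open>y\<close> and \<open>w\<close> reaches \<open>0\<close>.\<close>
    define t where "t = - s y / (2 * (s w - s y))"
    have t: "0 < t" "t < 1"
      using neg \<open>0 \<le> s w\<close> by (auto simp: t_def field_simps)
    let ?v = "(1 - t) *\<^sub>R y + t *\<^sub>R w"
    have "h ?v \<le> (1 - t) * h y + t * h w"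
      using convex_onD[OF assms(1), of t y w] t that slater by simp
    also have "\<dots> < 0"
      using t that(2) slater(2)
      by (intro add_nonpos_neg mult_nonneg_nonpos mult_pos_neg) auto
    finally have "0 \<le> s ?v"
      using strict mem[of y w t] t that slater by simp
    also have "s ?v \<le> (1 - t) * s y + t * s w"
      using convex_onD[OF assms(2), of t y w] t that slater by simp
    also have "\<dots> = s y + t * (s w - s y)"
      by (simp add: algebra_simps)
    also have "\<dots> = s y / 2"
      using neg \<open>0 \<le> s w\<close> by (simp add: t_def field_simps)
    finally show False
      using neg by simp
  qed
  have cross: "- s y / h y \<le> s z / - h z"
    if "y \<in> S" "0 < h y" "z \<in> S" "h z < 0" for y z
  proof -
    define t where "t = - h z / (h y - h z)"
    have t: "0 \<le> t" "t \<le> 1" and t': "1 - t = h y / (h y - h z)"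
      using that by (auto simp: t_def field_simps)
    let ?v = "(1 - t) *\<^sub>R z + t *\<^sub>R y"
    have "h ?v \<le> (1 - t) * h z + t * h y"
      using convex_onD[OF assms(1), of t z y] t that by simp
    also have "\<dots> = 0"
      unfolding t' by (simp add: t_def)
    finally have "0 \<le> s ?v"
      using weak mem[of z y t] t that by simp
    also have "s ?v \<le> (1 - t) * s z + t * s y"
      using convex_onD[OF assms(2), of t z y] t that by simp
    also have "\<dots> = (h y * s z - h z * s y) / (h y - h z)"
      unfolding t' by (simp add: t_def diff_divide_distrib)
    finally have "0 \<le> h y * s z - h z * s y"
      using that by (simp add: zero_le_divide_iff)
    then show ?thesis
      using that by (simp add: field_simps)
  qed
  let ?Z = "{z \<in> S. h z < 0}"
  define \<mu> where "\<mu> = (INF z\<in>?Z. s z / - h z)"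
  have "?Z \<noteq> {}"
    using slater by blast
  have pos: "0 \<le> s z / - h z" if "z \<in> ?Z" for z
    using that strict by (intro divide_nonneg_nonneg) auto
  then have "0 \<le> \<mu>"
    unfolding \<mu>_def using \<open>?Z \<noteq> {}\<close> by (intro cINF_greatest) auto
  moreover have "0 \<le> s y + \<mu> * h y" if "y \<in> S" for y
  proof (cases "h y" "0 :: real" rule: linorder_cases)
    case less
    have "\<mu> \<le> s y / - h y"
      unfolding \<mu>_def using that less pos by (intro cINF_lower bdd_belowI2[of _ 0]) auto
    with less show ?thesis
      by (simp add: field_simps)
  next
    case equal
    with weak that show ?thesis
      by simp
  next
    case greater
    have "- s y / h y \<le> \<mu>"
      unfolding \<mu>_def using that greater cross \<open>?Z \<noteq> {}\<close> by (intro cINF_greatest) auto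
    with greater show ?thesis
      by (simp add: field_simps)
  qed
  ultimately show ?thesis
    by blast
qed

text \<open>
  The multiplier \<open>\<mu>\<close> satisfies \<open>gf l \<bullet> (y - l) + \<mu> h y \<ge> 0\<close> for all \<open>y\<close>, where \<open>h\<close> is the linearized
  constraint. At \<open>y = l\<close> this is complementary slackness. If \<open>\<mu> > 0\<close>, the constraint is active at
  \<open>l\<close>, and dividing by \<open>\<mu>\<close> turns the inequality into the subgradient inequality of \<open>P1\<close> for
  \<open>\<zeta> - gf l / \<mu>\<close>. If \<open>\<mu> = 0\<close>, it forces \<open>gf l = 0\<close>.
\<close>
lemma stationary_point_if_minimizes_linearization:
  fixes P1 P2 :: "'a::euclidean_space \<Rightarrow> real"
  assumes "convex_on UNIV P1" "l \<in> feasible_set P1 P2 \<sigma>" "\<zeta> \<in> subdifferential P2 l"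
    and slater: "P1 w - P2 l - \<zeta> \<bullet> (w - l) < \<sigma>"
    and minimal: "\<And>y. P1 y - P2 l - \<zeta> \<bullet> (y - l) < \<sigma> \<Longrightarrow> 0 \<le> gf l \<bullet> (y - l)"
  shows "stationary_point gf P1 P2 \<sigma> l"
proof -
  let ?h = "\<lambda>y. P1 y - P2 l - \<zeta> \<bullet> (y - l) - \<sigma>"
  have "convex_on UNIV ?h"
  proof (rule convex_onI)
    fix t :: real and y z :: 'a
    assume "0 < t" "t < 1"
    then have "P1 ((1 - t) *\<^sub>R y + t *\<^sub>R z) \<le> (1 - t) * P1 y + t * P1 z"
      using convex_onD[OF assms(1), of t y z] by simp
    then show "?h ((1 - t) *\<^sub>R y + t *\<^sub>R z) \<le> (1 - t) * ?h y + t * ?h z"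
      by (simp add: algebra_simps inner_diff_right inner_add_right)
  qed auto
  moreover have "convex_on UNIV (\<lambda>y. gf l \<bullet> (y - l))"
    by (rule convex_onI) (auto simp: algebra_simps inner_diff_right inner_add_right)
  ultimately obtain \<mu> where "\<mu> \<ge> 0" and \<mu>: "\<And>y. 0 \<le> gf l \<bullet> (y - l) + \<mu> * ?h y"
    using lagrange_multiplier_exists[of UNIV ?h "\<lambda>y. gf l \<bullet> (y - l)" w] minimal slater by auto
  have feasible: "P1 l - P2 l \<le> \<sigma>"
    using assms(2) by (simp add: feasible_set_def)
  have "\<mu> * (P1 l - P2 l - \<sigma>) \<ge> 0"
    using \<mu>[of l] by simp
  with \<open>\<mu> \<ge> 0\<close> feasible have slack: "\<mu> * (P1 l - P2 l - \<sigma>) = 0"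
    by (meson antisym diff_le_0_iff_le mult_nonneg_nonpos)
  have "\<exists>p\<in>subdifferential P1 l. gf l + \<mu> *\<^sub>R (p - \<zeta>) = 0"
  proof (cases "\<mu> = 0")
    case True
    then have "gf l \<bullet> gf l \<le> 0"
      using \<mu>[of "l - gf l"] by simp
    then have "gf l = 0"
      using inner_gt_zero_iff[of "gf l"] by linarith
    with True subdifferential_nonempty[OF assms(1)] show ?thesis
      by auto
  next
    case False
    with \<open>\<mu> \<ge> 0\<close> have "\<mu> > 0"
      by simp
    let ?p = "\<zeta> - gf l /\<^sub>R \<mu>"
    have "P1 l + ?p \<bullet> (y - l) \<le> P1 y" for y
    proof -
      have "?h y = P1 y - P1 l - \<zeta> \<bullet> (y - l)"
        using slack False by simp
      with \<mu>[of y] have "0 \<le> gf l \<bullet> (y - l) + \<mu> * (P1 y - P1 l - \<zeta> \<bullet> (y - l))"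
        by simp
      with \<open>\<mu> > 0\<close> have "0 \<le> (gf l \<bullet> (y - l)) / \<mu> + (P1 y - P1 l - \<zeta> \<bullet> (y - l))"
        by (simp add: field_simps)
      then show ?thesis
        by (simp add: inner_diff_left divide_inverse mult.commute)
    qed
    then have "?p \<in> subdifferential P1 l"
      by (simp add: subdifferential_def)
    moreover have "gf l + \<mu> *\<^sub>R (?p - \<zeta>) = 0"
      using False by simp
    ultimately show ?thesis
      by blast
  qed
  then obtain p where "p \<in> subdifferential P1 l" "0 = gf l + \<mu> *\<^sub>R (p - \<zeta>)"
    by metis
  with \<open>\<mu> \<ge> 0\<close> slack feasible assms(3) show ?thesis
    unfolding stationary_point_def by blast
qed

section \<open>The Armijo line search\<close>

text \<open>
  By the mean value theorem the decrease along a step is governed by the slope at an intermediate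
  point of the segment. Uniform continuity of the gradient on \<open>K\<close> makes this slope differ from the
  initial one by at most the fraction \<open>1 - c\<close> of \<open>\<epsilon>\<close>, with one \<open>\<delta>\<close> for all segments.
\<close>
lemma armijo_accepts_short_steps:
  fixes f :: "'a::euclidean_space \<Rightarrow> real"
  assumes "\<And>z. GDERIV f z :> gf z" "continuous_on K gf" "compact K" "convex K" "c < 1" "\<epsilon> > 0"
  shows "\<exists>\<delta>>0. \<forall>x\<in>K. \<forall>u\<in>K. \<forall>\<beta>. 0 < \<beta> \<and> \<beta> < \<delta> \<and> \<beta> \<le> 1 \<and> gf x \<bullet> (u - x) \<le> - \<epsilon>
           \<longrightarrow> armijo f gf c x (u - x) \<beta>"
proof -
  obtain D where "D > 0" and D: "\<And>x u. x \<in> K \<Longrightarrow> u \<in> K \<Longrightarrow> norm (u - x) \<le> D"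
  proof -
    have "bounded K"
      using assms(3) compact_imp_bounded by blast
    then obtain B where "B > 0" and B: "\<forall>x\<in>K. norm x \<le> B"
      by (auto simp: bounded_pos)
    show thesis
    proof (rule that[of "2 * B"])
      show "norm (u - x) \<le> 2 * B" if "x \<in> K" "u \<in> K" for x u
        using bspec[OF B that(1)] bspec[OF B that(2)] norm_triangle_ineq4[of u x] by linarith
    qed (use \<open>B > 0\<close> in simp)
  qed
  have "uniformly_continuous_on K gf"
    using assms(2,3) compact_uniformly_continuous by blast
  moreover have "(1 - c) * \<epsilon> / D > 0"
    using assms(5,6) \<open>D > 0\<close> by simp
  ultimately obtain \<rho> where "\<rho> > 0"
    and \<rho>: "\<And>z x. z \<in> K \<Longrightarrow> x \<in> K \<Longrightarrow> dist z x < \<rho> \<Longrightarrow> dist (gf z) (gf x) < (1 - c) * \<epsilon> / D"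
    unfolding uniformly_continuous_on_def by metis
  have "armijo f gf c x (u - x) \<beta>"
    if "x \<in> K" "u \<in> K" "\<beta> < \<rho> / D" "\<beta> \<le> 1" and "0 < \<beta>" and slope: "gf x \<bullet> (u - x) \<le> - \<epsilon>" for x u \<beta>
  proof -
    let ?d = "u - x"
    have "DERIV (\<lambda>t. f (x + t *\<^sub>R ?d)) t :> gf (x + t *\<^sub>R ?d) \<bullet> ?d" for t
    proof -
      have "((\<lambda>t. x + t *\<^sub>R ?d) has_derivative (\<lambda>s. s *\<^sub>R ?d)) (at t)"
        by (auto intro!: derivative_eq_intros)
      moreover have "(f has_derivative (\<lambda>h. h \<bullet> gf (x + t *\<^sub>R ?d))) (at (x + t *\<^sub>R ?d))"
        using assms(1) by (simp add: gderiv_def)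
      ultimately have "((\<lambda>t. f (x + t *\<^sub>R ?d)) has_derivative
          (\<lambda>s. (s *\<^sub>R ?d) \<bullet> gf (x + t *\<^sub>R ?d))) (at t)"
        by (rule has_derivative_compose)
      then show ?thesis
        by (rule has_derivative_imp_has_field_derivative) (simp add: inner_commute)
    qed
    then obtain t where t: "0 < t" "t < \<beta>"
      and mvt: "f (x + \<beta> *\<^sub>R ?d) - f x = \<beta> * (gf (x + t *\<^sub>R ?d) \<bullet> ?d)"
      using MVT2[of 0 \<beta> "\<lambda>t. f (x + t *\<^sub>R ?d)" "\<lambda>t. gf (x + t *\<^sub>R ?d) \<bullet> ?d"] \<open>0 < \<beta>\<close> by auto
    let ?z = "x + t *\<^sub>R ?d"
    have "?z = (1 - t) *\<^sub>R x + t *\<^sub>R u"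
      by (simp add: algebra_simps)
    then have "?z \<in> K"
      using assms(4) that t by (simp add: convex_alt)
    moreover have "dist ?z x < \<rho>"
    proof -
      have "dist ?z x = t * norm ?d"
        using t by (simp add: dist_norm)
      also have "\<dots> \<le> t * D"
        using t D[OF that(1,2)] by simp
      also have "\<dots> < \<rho>"
        using mult_strict_right_mono[of t "\<rho> / D" D] t that(3) \<open>D > 0\<close> by simp
      finally show ?thesis .
    qed
    ultimately have "norm (gf ?z - gf x) < (1 - c) * \<epsilon> / D"
      using \<rho> that(1) by (simp add: dist_norm)
    then have "norm (gf ?z - gf x) * norm ?d \<le> (1 - c) * \<epsilon> / D * D"
      using D[OF that(1,2)] \<open>(1 - c) * \<epsilon> / D > 0\<close> by (intro mult_mono) auto
    then have "(gf ?z - gf x) \<bullet> ?d \<le> (1 - c) * \<epsilon> / D * D"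
      using norm_cauchy_schwarz order_trans by blast
    also have "\<dots> \<le> (1 - c) * - (gf x \<bullet> ?d)"
      using \<open>D > 0\<close> assms(5) slope mult_left_mono[of \<epsilon> "- (gf x \<bullet> ?d)" "1 - c"] by simp
    finally have "gf ?z \<bullet> ?d \<le> c * (gf x \<bullet> ?d)"
      by (simp add: inner_diff_left algebra_simps)
    then have "\<beta> * (gf ?z \<bullet> ?d) \<le> \<beta> * (c * (gf x \<bullet> ?d))"
      using \<open>0 < \<beta>\<close> by simp
    with mvt show ?thesis
      by (simp add: armijo_def algebra_simps)
  qed
  then show ?thesis
    using \<open>\<rho> > 0\<close> \<open>D > 0\<close> by (intro exI[of _ "\<rho> / D"]) auto
qed

section \<open>Runs of the algorithm\<close>

lemma linearized_set_subset_feasible_set: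
  assumes "\<xi> \<in> subdifferential P2 y"
  shows "linearized_set P1 P2 \<sigma> y \<xi> \<subseteq> feasible_set P1 P2 \<sigma>"
proof
  fix z
  assume "z \<in> linearized_set P1 P2 \<sigma> y \<xi>"
  moreover have "P2 y + \<xi> \<bullet> (z - y) \<le> P2 z"
    using assms by (simp add: subdifferential_def)
  ultimately show "z \<in> feasible_set P1 P2 \<sigma>"
    by (simp add: linearized_set_def feasible_set_def)
qed

lemma mem_linearized_set_self:
  "y \<in> linearized_set P1 P2 \<sigma> y \<xi> \<longleftrightarrow> y \<in> feasible_set P1 P2 \<sigma>"
  by (simp add: linearized_set_def feasible_set_def)

lemma FW_infinite_run_feasible:
  assumes "FW_infinite_run f gf P1 P2 \<sigma> c \<eta> \<alpha>0 x \<xi> u j"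
  shows "x k \<in> feasible_set P1 P2 \<sigma>"
  using assms by (cases k) (auto simp: FW_infinite_run_def Let_def)

lemma FW_infinite_run_subgradient:
  assumes "FW_infinite_run f gf P1 P2 \<sigma> c \<eta> \<alpha>0 x \<xi> u j"
  shows "\<xi> k \<in> subdifferential P2 (x k)"
  using assms by (simp add: FW_infinite_run_def Let_def)

lemma FW_infinite_run_oracle:
  assumes "FW_infinite_run f gf P1 P2 \<sigma> c \<eta> \<alpha>0 x \<xi> u j"
  shows "u k \<in> linearized_set P1 P2 \<sigma> (x k) (\<xi> k)"
    and "y \<in> linearized_set P1 P2 \<sigma> (x k) (\<xi> k) \<Longrightarrow> gf (x k) \<bullet> u k \<le> gf (x k) \<bullet> y"
proof -
  have "is_LO_output P1 P2 \<sigma> (gf (x k)) (x k) (\<xi> k) (u k)"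
    using assms by (simp add: FW_infinite_run_def Let_def)
  then show "u k \<in> linearized_set P1 P2 \<sigma> (x k) (\<xi> k)"
    and "y \<in> linearized_set P1 P2 \<sigma> (x k) (\<xi> k) \<Longrightarrow> gf (x k) \<bullet> u k \<le> gf (x k) \<bullet> y"
    by (auto simp: is_LO_output_def is_arg_min_def not_less)
qed

text \<open>
  Let \<open>g k\<close> be the slope in question and \<open>\<alpha>\<^sub>k\<close> the accepted step. The total decrease of \<open>f\<close> is
  finite, so \<open>\<alpha>\<^sub>k g k \<longlonglongrightarrow> 0\<close>. If \<open>g k \<le> - \<epsilon>\<close>, then either the first
  trial was accepted and \<open>\<alpha>\<^sub>k\<close> is at least the infimum of the initial steps, or the previous trial
  \<open>\<alpha>\<^sub>k / \<eta>\<close> was rejected and so is not below the threshold under which every step is accepted. In both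
  cases \<open>\<alpha>\<^sub>k\<close> is bounded away from \<open>0\<close>, which can happen only finitely often.
\<close>
lemma FW_infinite_run_slope_tendsto_0:
  fixes f P1 P2 :: "'a::euclidean_space \<Rightarrow> real"
  assumes grad: "\<And>z. GDERIV f z :> gf z" and cont: "continuous_on UNIV gf"
    and "compact (feasible_set P1 P2 \<sigma>)"
    and run: "FW_infinite_run f gf P1 P2 \<sigma> c \<eta> \<alpha>0 x \<xi> u j"
  shows "(\<lambda>k. gf (x k) \<bullet> (u k - x k)) \<longlonglongrightarrow> 0"
proof -
  let ?F = "feasible_set P1 P2 \<sigma>"
  let ?d = "\<lambda>k. u k - x k"
  define g where "g k = gf (x k) \<bullet> ?d k" for k
  define \<alpha> where "\<alpha> k = \<alpha>0 k * \<eta> ^ j k" for k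
  have c: "0 < c" "c < 1" and \<eta>: "0 < \<eta>" "\<eta> < 1"
    and \<alpha>0: "\<And>k. 0 < \<alpha>0 k" "\<And>k. \<alpha>0 k \<le> 1" and inf: "(INF k. \<alpha>0 k) > 0"
    and accept: "\<And>k. armijo f gf c (x k) (?d k) (\<alpha> k)"
    and reject: "\<And>k i. i < j k \<Longrightarrow> \<not> armijo f gf c (x k) (?d k) (\<alpha>0 k * \<eta> ^ i)"
    and decrease: "\<And>k. f (x (Suc k)) \<le> f (x k + \<alpha> k *\<^sub>R ?d k)"
    using run by (auto simp: FW_infinite_run_def Let_def \<alpha>_def)
  have xF: "x k \<in> ?F" for k
    by (rule FW_infinite_run_feasible[OF run])
  have uF: "u k \<in> ?F" for k
    using linearized_set_subset_feasible_set[OF FW_infinite_run_subgradient[OF run]]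
      FW_infinite_run_oracle(1)[OF run] by blast
  have g_nonpos: "g k \<le> 0" for k
    using FW_infinite_run_oracle(2)[OF run, of "x k" k] xF[of k]
    by (simp add: g_def inner_diff_right mem_linearized_set_self)
  have \<alpha>_pos: "\<alpha> k > 0" for k
    using \<alpha>0 \<eta> by (simp add: \<alpha>_def)
  have descent: "c * \<alpha> k * - g k \<le> f (x k) - f (x (Suc k))" for k
    using accept[of k] decrease[of k] by (simp add: armijo_def g_def algebra_simps)
  have "(\<lambda>k. \<alpha> k * g k) \<longlonglongrightarrow> 0"
  proof -
    have "continuous_on ?F f"
      using grad unfolding gderiv_def
      by (meson continuous_at_imp_continuous_on has_derivative_continuous)
    then have "bounded (f ` ?F)"
      by (intro compact_imp_bounded compact_continuous_image assms(3))
    then obtain B where "\<And>z. z \<in> ?F \<Longrightarrow> \<bar>f z\<bar> \<le> B"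
      by (auto simp: bounded_iff)
    then have "\<forall>k. - B \<le> f (x k)"
      using xF by (metis abs_le_D2 minus_le_iff)
    moreover have "decseq (\<lambda>k. f (x k))"
    proof (rule decseq_SucI)
      fix k
      have "0 \<le> c * \<alpha> k * - g k"
        using c \<alpha>_pos[of k] g_nonpos[of k] by (intro mult_nonneg_nonneg) auto
      with descent[of k] show "f (x (Suc k)) \<le> f (x k)"
        by linarith
    qed
    ultimately obtain L where L: "(\<lambda>k. f (x k)) \<longlonglongrightarrow> L"
      using decseq_convergent by metis
    have "(\<lambda>k. (f (x k) - f (x (Suc k))) / c) \<longlonglongrightarrow> (L - L) / c"
      using c by (intro tendsto_intros L LIMSEQ_Suc) auto
    then have "(\<lambda>k. (f (x k) - f (x (Suc k))) / c) \<longlonglongrightarrow> 0"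
      by simp
    moreover have "norm (\<alpha> k * g k) \<le> (f (x k) - f (x (Suc k))) / c" for k
      using descent[of k] c \<alpha>_pos[of k] g_nonpos[of k]
      by (simp add: abs_mult field_simps)
    ultimately show ?thesis
      by (rule Lim_null_comparison[OF always_eventually[OF allI], rotated])
  qed
  have "g \<longlonglongrightarrow> 0"
  proof (rule LIMSEQ_I)
    fix \<epsilon> :: real
    assume "\<epsilon> > 0"
    \<comment> \<open>The short-step lemma needs a convex compact set; the feasible set need not be convex.\<close>
    obtain B where "\<forall>z\<in>?F. norm z \<le> B"
      using compact_imp_bounded[OF assms(3)] by (auto simp: bounded_iff)
    then have B: "z \<in> cball 0 B" if "z \<in> ?F" for z
      using that by simp
    obtain \<delta> where "\<delta> > 0" and \<delta>: "\<forall>z\<in>cball 0 B. \<forall>v\<in>cball 0 B. \<forall>\<beta>.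
        0 < \<beta> \<and> \<beta> < \<delta> \<and> \<beta> \<le> 1 \<and> gf z \<bullet> (v - z) \<le> - \<epsilon> \<longrightarrow> armijo f gf c z (v - z) \<beta>"
      using armijo_accepts_short_steps[OF grad continuous_on_subset[OF cont subset_UNIV]
          compact_cball convex_cball c(2) \<open>\<epsilon> > 0\<close>] by blast
    define m where "m = min (INF k. \<alpha>0 k) (\<eta> * \<delta>)"
    have "m > 0"
      using inf \<eta> \<open>\<delta> > 0\<close> by (simp add: m_def)
    have step: "m \<le> \<alpha> k" if "g k \<le> - \<epsilon>" for k
    proof (cases "j k")
      case 0
      have "(INF k. \<alpha>0 k) \<le> \<alpha>0 k"
        using \<alpha>0(1) by (intro cINF_lower bdd_belowI2[of _ 0]) (auto intro: less_imp_le)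
      with 0 show ?thesis
        by (simp add: m_def \<alpha>_def)
    next
      case (Suc i)
      let ?\<beta> = "\<alpha>0 k * \<eta> ^ i"
      have "0 < ?\<beta>" "?\<beta> \<le> 1"
        using \<alpha>0[of k] \<eta> by (auto intro!: mult_le_one power_le_one)
      moreover have "\<not> armijo f gf c (x k) (?d k) ?\<beta>"
        using reject Suc by simp
      moreover have "?\<beta> < \<delta> \<Longrightarrow> 0 < ?\<beta> \<Longrightarrow> ?\<beta> \<le> 1 \<Longrightarrow> armijo f gf c (x k) (?d k) ?\<beta>"
        using \<delta> B[OF xF] B[OF uF] that unfolding g_def by blast
      ultimately have "\<delta> \<le> ?\<beta>"
        using not_le by blast
      then have "\<eta> * \<delta> \<le> \<eta> * ?\<beta>"
        using \<eta> by simp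
      with Suc show ?thesis
        by (simp add: m_def \<alpha>_def algebra_simps)
    qed
    have "eventually (\<lambda>k. norm (\<alpha> k * g k - 0) < m * \<epsilon>) sequentially"
      using \<open>(\<lambda>k. \<alpha> k * g k) \<longlonglongrightarrow> 0\<close> \<open>m > 0\<close> \<open>\<epsilon> > 0\<close> by (auto simp: tendsto_iff dist_norm)
    then have "eventually (\<lambda>k. norm (g k - 0) < \<epsilon>) sequentially"
    proof eventually_elim
      case (elim k)
      show ?case
      proof (rule ccontr)
        assume "\<not> ?case"
        with g_nonpos[of k] have "\<epsilon> \<le> - g k"
          by simp
        then have "m * \<epsilon> \<le> \<alpha> k * - g k"
          using step[of k] \<open>m > 0\<close> \<open>\<epsilon> > 0\<close> by (intro mult_mono) auto
        with elim show False
          by simp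
      qed
    qed
    then show "\<exists>N. \<forall>k\<ge>N. norm (g k - 0) < \<epsilon>"
      by (simp add: eventually_sequentially)
  qed
  then show ?thesis
    by (simp add: g_def [abs_def])
qed

lemma gap_function_bounds:
  fixes P1 P2 :: "'a::euclidean_space \<Rightarrow> real"
  assumes "convex_on UNIV P1" "compact (feasible_set P1 P2 \<sigma>)"
    and "x \<in> feasible_set P1 P2 \<sigma>" "\<xi> \<in> subdifferential P2 x"
    and max: "\<And>y. y \<in> linearized_set P1 P2 \<sigma> x \<xi> \<Longrightarrow> gf x \<bullet> (x - y) \<le> b"
  shows "0 \<le> gap_function gf P1 P2 \<sigma> x" "gap_function gf P1 P2 \<sigma> x \<le> b"
proof -
  let ?M = "\<lambda>\<xi>. SUP y\<in>linearized_set P1 P2 \<sigma> x \<xi>. gf x \<bullet> (x - y)"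
  have nonneg: "0 \<le> ?M \<zeta>" if "\<zeta> \<in> subdifferential P2 x" for \<zeta>
    using gap_function_max_nonneg[OF assms(1-3) that] .
  show "0 \<le> gap_function gf P1 P2 \<sigma> x"
    unfolding gap_function_def using nonneg assms(4) by (intro cINF_greatest) auto
  have "gap_function gf P1 P2 \<sigma> x \<le> ?M \<xi>"
    unfolding gap_function_def using nonneg assms(4)
    by (intro cINF_lower bdd_belowI2[of _ 0]) auto
  also have "?M \<xi> \<le> b"
    using assms(3) max mem_linearized_set_self by (intro cSUP_least) blast+
  finally show "gap_function gf P1 P2 \<sigma> x \<le> b" .
qed

text \<open>
  Only points satisfying the limiting constraint strictly are sure to lie in the linearized sets
  along the run, where they compete with the outputs of the oracle; this is why the multiplier
  above is derived from strictly feasible points.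
\<close>
lemma FW_infinite_run_accumulation_point_stationary:
  fixes f P1 P2 :: "'a::euclidean_space \<Rightarrow> real"
  assumes grad: "\<And>z. GDERIV f z :> gf z" and cont: "continuous_on UNIV gf"
    and convex: "convex_on UNIV P1" "convex_on UNIV P2"
    and compact: "compact (feasible_set P1 P2 \<sigma>)"
    and slater: "\<And>y \<zeta>. y \<in> feasible_set P1 P2 \<sigma> \<Longrightarrow> \<zeta> \<in> subdifferential P2 y \<Longrightarrow>
           \<exists>w. P1 w - P2 y - \<zeta> \<bullet> (w - y) < \<sigma>"
    and run: "FW_infinite_run f gf P1 P2 \<sigma> c \<eta> \<alpha>0 x \<xi> u j"
    and "accumulation_point x l"
  shows "stationary_point gf P1 P2 \<sigma> l"
proof -
  let ?F = "feasible_set P1 P2 \<sigma>"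
  have xF: "x k \<in> ?F" for k
    by (rule FW_infinite_run_feasible[OF run])
  have sub: "\<xi> k \<in> subdifferential P2 (x k)" for k
    by (rule FW_infinite_run_subgradient[OF run])
  obtain r where r: "strict_mono r" "(x \<circ> r) \<longlonglongrightarrow> l"
    using assms(8) by (auto simp: accumulation_point_def)
  have "bounded (\<Union>y\<in>?F. subdifferential P2 y)"
    using bounded_subdifferential_image[OF convex(2) compact_imp_bounded[OF compact]] .
  moreover have "range (\<xi> \<circ> r) \<subseteq> (\<Union>y\<in>?F. subdifferential P2 y)"
    using sub xF by auto
  ultimately obtain \<zeta> q where q: "strict_mono q" "(\<xi> \<circ> r \<circ> q) \<longlonglongrightarrow> \<zeta>"
    using bounded_imp_convergent_subsequence bounded_subset by blast
  define p where "p = r \<circ> q"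
  have "strict_mono p"
    using r(1) q(1) by (simp add: p_def strict_mono_o)
  have xl: "(\<lambda>k. x (p k)) \<longlonglongrightarrow> l"
    using LIMSEQ_subseq_LIMSEQ[OF r(2) q(1)] by (simp add: p_def comp_def)
  have \<xi>\<zeta>: "(\<lambda>k. \<xi> (p k)) \<longlonglongrightarrow> \<zeta>"
    using q(2) by (simp add: p_def comp_def)
  have P2_cont: "continuous_on UNIV P2"
    by (rule convex_on_continuous[OF open_UNIV convex(2)])
  have lF: "l \<in> ?F"
    using closed_sequentially[OF compact_imp_closed[OF compact] _ xl] xF by blast
  have \<zeta>_sub: "\<zeta> \<in> subdifferential P2 l"
    by (rule subdifferential_closed_graph[OF sub xl \<xi>\<zeta> P2_cont])
  have P2_lim: "(\<lambda>k. P2 (x (p k))) \<longlonglongrightarrow> P2 l"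
    using continuous_on_tendsto_compose[OF P2_cont xl] by simp
  have gf_lim: "(\<lambda>k. gf (x (p k))) \<longlonglongrightarrow> gf l"
    using continuous_on_tendsto_compose[OF cont xl] by simp
  have "0 \<le> gf l \<bullet> (y - l)" if y: "P1 y - P2 l - \<zeta> \<bullet> (y - l) < \<sigma>" for y
  proof (rule tendsto_le[OF sequentially_bot])
    show "(\<lambda>k. gf (x (p k)) \<bullet> (y - x (p k))) \<longlonglongrightarrow> gf l \<bullet> (y - l)"
      by (intro tendsto_intros gf_lim xl)
    show "(\<lambda>k. gf (x (p k)) \<bullet> (u (p k) - x (p k))) \<longlonglongrightarrow> 0"
      using LIMSEQ_subseq_LIMSEQ[OF FW_infinite_run_slope_tendsto_0[OF grad cont compact run]
          \<open>strict_mono p\<close>] by (simp add: comp_def)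
    have "(\<lambda>k. P1 y - P2 (x (p k)) - \<xi> (p k) \<bullet> (y - x (p k))) \<longlonglongrightarrow> P1 y - P2 l - \<zeta> \<bullet> (y - l)"
      by (intro tendsto_intros P2_lim \<xi>\<zeta> xl)
    then have "eventually (\<lambda>k. P1 y - P2 (x (p k)) - \<xi> (p k) \<bullet> (y - x (p k)) < \<sigma>) sequentially"
      using y by (rule order_tendstoD)
    then show "eventually (\<lambda>k. gf (x (p k)) \<bullet> (u (p k) - x (p k)) \<le> gf (x (p k)) \<bullet> (y - x (p k)))
        sequentially"
    proof eventually_elim
      case (elim k)
      then have "y \<in> linearized_set P1 P2 \<sigma> (x (p k)) (\<xi> (p k))"
        by (simp add: linearized_set_def)
      from FW_infinite_run_oracle(2)[OF run this] show ?case
        by (simp add: inner_diff_right)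
    qed
  qed
  with slater[OF lF \<zeta>_sub] show ?thesis
    using stationary_point_if_minimizes_linearization[OF convex(1) lF \<zeta>_sub] by blast
qed

theorem theorem4:
  fixes f P1 P2 :: "'a::euclidean_space \<Rightarrow> real" and gf :: "'a \<Rightarrow> 'a"
    and \<sigma> c \<eta> :: real and \<alpha>0 :: "nat \<Rightarrow> real"
    and x \<xi> u :: "nat \<Rightarrow> 'a" and j :: "nat \<Rightarrow> nat"
  assumes "\<And>z. GDERIV f z :> gf z" and "continuous_on UNIV gf"
    and "convex_on UNIV P1" and "convex_on UNIV P2"
    and "\<sigma> > 0"
    and "feasible_set P1 P2 \<sigma> \<noteq> {}" and "compact (feasible_set P1 P2 \<sigma>)"
    and "\<And>y \<zeta>. y \<in> feasible_set P1 P2 \<sigma> \<Longrightarrow> \<zeta> \<in> subdifferential P2 y \<Longrightarrow>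
           \<exists>w. P1 w - P2 y - \<zeta> \<bullet> (w - y) < \<sigma>"
    and "FW_infinite_run f gf P1 P2 \<sigma> c \<eta> \<alpha>0 x \<xi> u j"
  shows "bounded (range x) \<and>
         (\<lambda>k. gap_function gf P1 P2 \<sigma> (x k)) \<longlonglongrightarrow> 0 \<and>
         (\<forall>l. accumulation_point x l \<longrightarrow> stationary_point gf P1 P2 \<sigma> l)"
proof (intro conjI allI impI)
  note run = assms(9)
  have xF: "x k \<in> feasible_set P1 P2 \<sigma>" for k
    by (rule FW_infinite_run_feasible[OF run])
  then show "bounded (range x)"
    by (intro bounded_subset[OF compact_imp_bounded[OF assms(7)]] image_subsetI)
  have gap: "0 \<le> gap_function gf P1 P2 \<sigma> (x k)"
      "gap_function gf P1 P2 \<sigma> (x k) \<le> - (gf (x k) \<bullet> (u k - x k))" for k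
    using gap_function_bounds[OF assms(3,7) xF[of k] FW_infinite_run_subgradient[OF run, of k],
        where gf = gf and b = "- (gf (x k) \<bullet> (u k - x k))"] FW_infinite_run_oracle(2)[OF run, of _ k]
    by (auto simp: inner_diff_right)
  have lim: "(\<lambda>k. - (gf (x k) \<bullet> (u k - x k))) \<longlonglongrightarrow> 0"
    using tendsto_minus[OF FW_infinite_run_slope_tendsto_0[OF assms(1,2,7) run]] by simp
  show "(\<lambda>k. gap_function gf P1 P2 \<sigma> (x k)) \<longlonglongrightarrow> 0"
    by (rule tendsto_sandwich[OF _ _ tendsto_const lim]) (use gap in \<open>auto intro: always_eventually\<close>)
  show "stationary_point gf P1 P2 \<sigma> l" if "accumulation_point x l" for l
    by (rule FW_infinite_run_accumulation_point_stationary[OF assms(1-4,7-9) that])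
qed

end
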